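(* Let $G$ be a finite simple undirected graph with nonempty vertex set. Then $G$ is the niche graph of an interval order if and only if $G$ is (isomorphic to) one of the following graphs, for some positive integers $m$, $n$, $q$, $r$: (i) an edgeless graph $I_q$; (ii) the union of two complete graphs $K_m \cup K_n$; (iii) the union of two complete graphs and an edgeless graph $K_m \cup K_n \cup I_r$; (iv) the complement of the union of a complete bipartite graph and an edgeless graph, $\overline{K_{m,n} \cup I_q}$; (v) the union of an edgeless graph and the complement of the union of a complete bipartite graph and an edgeless graph, $I_r \cup \overline{K_{m,n} \cup I_q}$.
   Context: All graphs and digraphs are finite with nonempty vertex set; graphs are simple and undirected. For a digraph $D=(V,A)$ with vertex set $V(D)=V$ and arc set $A(D)=A$, and $x \in V$, let $N^+_D(x)=\{v \in V \mid (x,v)\in A\}$ and $N^-_D(x)=\{v\in V \mid (v,x)\in A\}$ be the sets of out-neighbors and in-neighbors of $x$. The niche graph of $D$ is the graph with the same vertex set as $D$ in which two distinct vertices $x$ and $y$ are adjacent if and only if $N^+_D(x)\cap N^+_D(y)\neq\emptyset$ or $N^-_D(x)\cap N^-_D(y)\neq\emptyset$. A digraph $D=(V,A)$ is an interval order if there exists an assignment $J$ of a closed real interval $J(x)\subset\mathbb{R}$ (that is, $J(x)=[a,b]=\{t\in\mathbb{R}\mid a\le t\le b\}$ for some reals $a\le b$ depending on $x$) to each vertex $x\in V$ such that, for all $x,y\in V$, $(x,y)\in A$ if and only if $\min J(x)>\max J(y)$. $K_n$ denotes the complete graph with $n$ vertices; $I_n$ denotes the edgeless graph with $n$ vertices;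 $K_{m,n}$ denotes the complete bipartite graph with partite sets of sizes $m$ and $n$. $G\cup H$ denotes the disjoint union of graphs $G$ and $H$. $\overline{G}$ denotes the complement of $G$ (same vertex set, two distinct vertices adjacent in $\overline{G}$ if and only if they are not adjacent in $G$). *)

theory Defs
  imports Complex_Main "Graph_Theory.Graph_Theory"
begin

text \<open>
  A finite simple undirected graph is an irreflexive symmetric finite digraph without parallel
  arcs (\<^locale>\<open>pair_graph\<close>): the edge joining \<open>u\<close> and \<open>v\<close> is represented by the two
  arcs \<open>(u, v)\<close> and \<open>(v, u)\<close>.
\<close>

definition out_nbrs :: "'a pair_pre_digraph \<Rightarrow> 'a \<Rightarrow> 'a set" where
  "out_nbrs D x = {v \<in> pverts D. (x, v) \<in> parcs D}"

definition in_nbrs :: "'a pair_pre_digraph \<Rightarrow> 'a \<Rightarrow> 'a set" where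
  "in_nbrs D x = {v \<in> pverts D. (v, x) \<in> parcs D}"

definition niche_graph :: "'a pair_pre_digraph \<Rightarrow> 'a pair_pre_digraph" where
  "niche_graph D = \<lparr> pverts = pverts D,
     parcs = {(x, y). x \<in> pverts D \<and> y \<in> pverts D \<and> x \<noteq> y \<and>
       (out_nbrs D x \<inter> out_nbrs D y \<noteq> {} \<or> in_nbrs D x \<inter> in_nbrs D y \<noteq> {})} \<rparr>"

text \<open>
  For a nonempty compact interval, \<^const>\<open>Inf\<close> and \<^const>\<open>Sup\<close> are its minimum and maximum.
\<close>

definition interval_order :: "'a pair_pre_digraph \<Rightarrow> bool" where
  "interval_order D \<longleftrightarrow> pair_fin_digraph D \<and> pverts D \<noteq> {} \<and>
     (\<exists>J :: 'a \<Rightarrow> real set.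
        (\<forall>x\<in>pverts D. \<exists>a b. a \<le> b \<and> J x = {a..b}) \<and>
        (\<forall>x\<in>pverts D. \<forall>y\<in>pverts D. (x, y) \<in> parcs D \<longleftrightarrow> Inf (J x) > Sup (J y)))"

definition complete_graph :: "nat \<Rightarrow> nat pair_pre_digraph" where
  "complete_graph n = \<lparr> pverts = {..<n}, parcs = {(i, j). i < n \<and> j < n \<and> i \<noteq> j} \<rparr>"

definition edgeless_graph :: "nat \<Rightarrow> nat pair_pre_digraph" where
  "edgeless_graph n = \<lparr> pverts = {..<n}, parcs = {} \<rparr>"

definition complete_bipartite_graph :: "nat \<Rightarrow> nat \<Rightarrow> (nat + nat) pair_pre_digraph" where
  "complete_bipartite_graph m n = \<lparr> pverts = {..<m} <+> {..<n},
     parcs = (Inl ` {..<m}) \<times> (Inr ` {..<n}) \<union> (Inr ` {..<n}) \<times> (Inl ` {..<m}) \<rparr>"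

definition disjoint_union ::
    "'a pair_pre_digraph \<Rightarrow> 'b pair_pre_digraph \<Rightarrow> ('a + 'b) pair_pre_digraph" where
  "disjoint_union G H = \<lparr> pverts = pverts G <+> pverts H,
     parcs = map_prod Inl Inl ` parcs G \<union> map_prod Inr Inr ` parcs H \<rparr>"

definition graph_complement :: "'a pair_pre_digraph \<Rightarrow> 'a pair_pre_digraph" where
  "graph_complement G = \<lparr> pverts = pverts G,
     parcs = {(x, y). x \<in> pverts G \<and> y \<in> pverts G \<and> x \<noteq> y \<and> (x, y) \<notin> parcs G} \<rparr>"

definition graph_iso :: "'a pair_pre_digraph \<Rightarrow> 'b pair_pre_digraph \<Rightarrow> bool" where
  "graph_iso G H \<longleftrightarrow> digraph_iso (with_proj G) (with_proj H)"

lemma complete_graph_is_complete: "complete_digraph n (with_proj (complete_graph n))"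
  by (auto simp: complete_digraph_pair_def complete_graph_def)

lemma complete_bipartite_graph_is_complete_bipartite:
  "complete_bipartite_digraph m n (with_proj (complete_bipartite_graph m n))"
proof -
  let ?U = "Inl ` {..<m} :: (nat + nat) set" and ?V = "Inr ` {..<n} :: (nat + nat) set"
  have "card ?U = m" "card ?V = n" by (simp_all add: card_image)
  moreover have "?U \<inter> ?V = {}" by auto
  ultimately show ?thesis
    unfolding complete_bipartite_digraph_pair_def complete_bipartite_graph_def Plus_def
    by auto
qed

lemma pair_graphI_finite:
  assumes "finite (pverts G)" "parcs G \<subseteq> pverts G \<times> pverts G"
    and "sym (parcs G)" "irrefl (parcs G)"
  shows "pair_graph G"
proof -
  have "finite (parcs G)"
    using assms by (meson finite_SigmaI finite_subset)
  with assms show ?thesis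
    by unfold_locales (auto simp: symmetric_def irrefl_def)
qed

lemma pair_graph_niche_graph:
  assumes "pair_fin_digraph D"
  shows "pair_graph (niche_graph D)"
  using pair_fin_digraph.pair_finite_verts[OF assms]
  by (intro pair_graphI_finite) (auto simp: niche_graph_def sym_def irrefl_def)

lemma graph_iso_iff:
  assumes "pair_wf_digraph G"
    and "pair_wf_digraph H"
  shows "graph_iso G H \<longleftrightarrow>
    (\<exists>f. bij_betw f (pverts G) (pverts H) \<and>
      (\<forall>x\<in>pverts G. \<forall>y\<in>pverts G. (x, y) \<in> parcs G \<longleftrightarrow> (f x, f y) \<in> parcs H))"
  (is "_ \<longleftrightarrow> (\<exists>f. ?iso f)")
proof
  assume "graph_iso G H"
  then obtain h where h: "pre_digraph.digraph_isomorphism (with_proj G) h"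
    and H: "with_proj H = app_iso h (with_proj G)"
    by (auto simp: graph_iso_def digraph_iso_def)
  from arg_cong[OF H, of verts] arg_cong[OF H, of arcs]
    arg_cong[OF H, of tail] arg_cong[OF H, of head]
  have eqs: "pverts H = iso_verts h ` pverts G" "parcs H = iso_arcs h ` parcs G"
    "iso_tail h = fst" "iso_head h = snd" by simp_all
  have ends: "iso_arcs h e = (iso_verts h (fst e), iso_verts h (snd e))" if "e \<in> parcs G" for e
    using h that eqs(3,4) by (auto simp: pre_digraph.digraph_isomorphism_def prod_eq_iff)
  have inj: "inj_on (iso_verts h) (pverts G)"
    using h by (auto simp: pre_digraph.digraph_isomorphism_def)
  have "(x, y) \<in> parcs G"
    if xy: "x \<in> pverts G" "y \<in> pverts G" "(iso_verts h x, iso_verts h y) \<in> parcs H" for x y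
  proof -
    obtain e where e: "e \<in> parcs G" "iso_arcs h e = (iso_verts h x, iso_verts h y)"
      using xy(3) eqs(2) by (metis imageE)
    with ends[OF e(1)] have "iso_verts h (fst e) = iso_verts h x" "iso_verts h (snd e) = iso_verts h y"
      by simp_all
    with inj xy(1,2) have "fst e = x" "snd e = y"
      using pair_wf_digraph.arc_fst_in_verts[OF assms(1) e(1)]
        pair_wf_digraph.arc_snd_in_verts[OF assms(1) e(1)]
      by (auto dest: inj_onD)
    with e(1) show ?thesis by force
  qed
  moreover have "(iso_verts h x, iso_verts h y) \<in> parcs H" if "(x, y) \<in> parcs G" for x y
    using ends[OF that] that eqs(2) by (metis fst_conv image_eqI snd_conv)
  ultimately have "?iso (iso_verts h)"
    using inj eqs(1) by (auto simp: bij_betw_def)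
  then show "\<exists>f. ?iso f" by blast
next
  assume "\<exists>f. ?iso f"
  then obtain f where f: "?iso f" by blast
  let ?h = "\<lparr> iso_verts = f, iso_arcs = map_prod f f, iso_head = snd, iso_tail = fst \<rparr>"
  have sub: "parcs G \<subseteq> pverts G \<times> pverts G" "parcs H \<subseteq> pverts H \<times> pverts H"
    using assms by (auto dest: pair_wf_digraph.wellformed')
  have inj: "inj_on f (pverts G)" and img: "f ` pverts G = pverts H"
    using f by (auto simp: bij_betw_def)
  have "inj_on (map_prod f f) (parcs G)"
    using map_prod_inj_on[OF inj inj] sub(1) by (rule inj_on_subset)
  then have "pre_digraph.digraph_isomorphism (with_proj G) ?h"
    using assms(1) inj by (auto simp: pre_digraph.digraph_isomorphism_def wf_digraph_wp_iff)
  moreover have "map_prod f f ` parcs G = parcs H"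
  proof (intro equalityI subsetI)
    fix e assume "e \<in> map_prod f f ` parcs G"
    then show "e \<in> parcs H" using f sub(1) by auto
  next
    fix e assume e: "e \<in> parcs H"
    obtain u v where uv: "e = (u, v)" by (cases e)
    with e sub(2) img obtain x y where "x \<in> pverts G" "y \<in> pverts G" "u = f x" "v = f y" by blast
    with f e uv show "e \<in> map_prod f f ` parcs G" by force
  qed
  then have "with_proj H = app_iso ?h (with_proj G)"
    using img by (simp add: app_iso_def with_proj_def)
  ultimately show "graph_iso G H"
    by (auto simp: graph_iso_def digraph_iso_def)
qed

end

theory Submission
  imports Defs
begin

text \<open>
  In an interval order the out-neighbourhoods form a chain under inclusion, since \<open>N\<^sup>+(x)\<close> depends
  only on the left endpoint of \<open>J(x)\<close> and grows with it. Hence two out-neighbourhoods meet as soon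
  as both are nonempty, and dually for in-neighbourhoods. Writing \<open>P\<close> for the vertices with an
  out-neighbour and \<open>Q\<close> for those with an in-neighbour, the niche graph is therefore the union of
  a clique on \<open>P\<close> and a clique on \<open>Q\<close>, which may overlap, together with isolated vertices
  (\<open>two_cliques_niche_graph\<close>).

  If there is an arc at all, an interval with the largest left endpoint belongs to \<open>P - Q\<close> and one
  with the smallest right endpoint to \<open>Q - P\<close>. So either \<open>P\<close> and \<open>Q\<close> are both empty, or both
  differences are nonempty (\<open>interval_order_end_vertices\<close>). This is the only restriction: the points
  \<open>2\<close>, \<open>0\<close>, \<open>1\<close> and the interval \<open>[0, 2]\<close>, given to the vertices of \<open>P - Q\<close>, \<open>Q - P\<close>, \<open>P \<inter> Q\<close>
  and to the remaining vertices, realise every such pair (\<open>two_cliques_realizable\<close>).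

  Up to isomorphism such a graph is determined by the sizes of these four cells
  (\<open>graph_iso_iff_two_cliques_type\<close>). The five families of the theorem are the possible
  combinations: no arcs gives (i); otherwise \<open>m = |P - Q|\<close> and \<open>n = |Q - P|\<close> are positive, and
  whether \<open>P \<inter> Q\<close> and the set of remaining vertices are empty or not selects (ii), (iii), (iv)
  or (v). The bipartite graph in (iv) and (v) consists of the non-edges between \<open>P - Q\<close>
  and \<open>Q - P\<close>.
\<close>

section \<open>Graphs covered by two cliques and isolated vertices\<close>

definition two_cliques :: "'a pair_pre_digraph \<Rightarrow> 'a set \<Rightarrow> 'a set \<Rightarrow> bool" where
  "two_cliques G P Q \<longleftrightarrow> P \<subseteq> pverts G \<and> Q \<subseteq> pverts G \<and>
     parcs G = {(x, y). x \<noteq> y \<and> (x \<in> P \<and> y \<in> P \<or> x \<in> Q \<and> y \<in> Q)}"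

definition two_cliques_type :: "'a pair_pre_digraph \<Rightarrow> nat \<Rightarrow> nat \<Rightarrow> nat \<Rightarrow> nat \<Rightarrow> bool" where
  "two_cliques_type G m n q r \<longleftrightarrow> (\<exists>P Q. two_cliques G P Q \<and>
     card (P - Q) = m \<and> card (Q - P) = n \<and> card (P \<inter> Q) = q \<and>
     card (pverts G - (P \<union> Q)) = r)"

lemma two_cliques_unique:
  assumes "two_cliques G P Q" "two_cliques H P Q" "pverts G = pverts H"
  shows "G = H"
  using assms by (simp add: two_cliques_def)

lemma two_cliques_wf: "two_cliques G P Q \<Longrightarrow> pair_wf_digraph G"
  by unfold_locales (auto simp: two_cliques_def)

text \<open>The bijection is glued from bijections between corresponding fibres.\<close>

lemma bij_betw_matching_labels:
  fixes f :: "'a \<Rightarrow> 'c" and g :: "'b \<Rightarrow> 'c"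
  assumes "finite A" "finite B"
    and card_eq: "\<And>c. card {x \<in> A. f x = c} = card {y \<in> B. g y = c}"
  obtains h where "bij_betw h A B" "\<And>x. x \<in> A \<Longrightarrow> g (h x) = f x"
proof -
  have "\<exists>h. bij_betw h {x \<in> A. f x = c} {y \<in> B. g y = c}" for c
    using assms by (intro finite_same_card_bij) auto
  then obtain k where k: "\<And>c. bij_betw (k c) {x \<in> A. f x = c} {y \<in> B. g y = c}"
    by metis
  define h where "h x = k (f x) x" for x
  have h: "h x \<in> B \<and> g (h x) = f x" if "x \<in> A" for x
    using bij_betwE[OF k[of "f x"]] that by (simp add: h_def)
  have "inj_on h A"
  proof (rule inj_onI)
    fix x y assume xy: "x \<in> A" "y \<in> A" "h x = h y"
    then have "f x = f y" using h by metis
    with xy show "x = y"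
      using bij_betw_imp_inj_on[OF k[of "f x"]] by (simp add: h_def inj_on_def)
  qed
  moreover have "B \<subseteq> h ` A"
  proof
    fix y assume "y \<in> B"
    then have "y \<in> k (g y) ` {x \<in> A. f x = g y}"
      using bij_betw_imp_surj_on[OF k[of "g y"]] by simp
    then obtain x where "x \<in> A" "f x = g y" "y = k (g y) x" by blast
    then show "y \<in> h ` A" by (intro image_eqI[of _ _ x]) (simp_all add: h_def)
  qed
  ultimately have "bij_betw h A B"
    using h by (auto simp: bij_betw_def)
  with h that show ?thesis by blast
qed

text \<open>
  Adjacency depends only on the cells of the two vertices, so a bijection that respects the cells is
  an isomorphism; conversely an isomorphism pulls the two cliques back.
\<close>

lemma graph_iso_iff_two_cliques_type:
  assumes G: "pair_graph G" and fin: "finite (pverts H)" and H: "two_cliques_type H m n q r"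
  shows "graph_iso G H \<longleftrightarrow> two_cliques_type G m n q r"
proof -
  obtain P Q where PQ: "two_cliques H P Q" and cards: "card (P - Q) = m" "card (Q - P) = n"
      "card (P \<inter> Q) = q" "card (pverts H - (P \<union> Q)) = r"
    using H by (auto simp: two_cliques_type_def)
  have sub: "P \<subseteq> pverts H" "Q \<subseteq> pverts H"
    using PQ by (auto simp: two_cliques_def)
  interpret G: pair_graph G by (rule G)
  note iso = graph_iso_iff[OF G.pair_wf_digraph_axioms two_cliques_wf[OF PQ]]
  show ?thesis
  proof
    assume "graph_iso G H"
    then obtain f where f: "bij_betw f (pverts G) (pverts H)"
      and arcs: "\<forall>x\<in>pverts G. \<forall>y\<in>pverts G. (x, y) \<in> parcs G \<longleftrightarrow> (f x, f y) \<in> parcs H"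
      unfolding iso by blast
    note inj = bij_betw_imp_inj_on[OF f] and img = bij_betw_imp_surj_on[OF f]
    define P' Q' where "P' = {x \<in> pverts G. f x \<in> P}" and "Q' = {x \<in> pverts G. f x \<in> Q}"
    have adj: "(x, y) \<in> parcs G \<longleftrightarrow> x \<noteq> y \<and> (x \<in> P' \<and> y \<in> P' \<or> x \<in> Q' \<and> y \<in> Q')" for x y
    proof (cases "x \<in> pverts G \<and> y \<in> pverts G")
      case True
      with arcs PQ have "(x, y) \<in> parcs G \<longleftrightarrow>
          f x \<noteq> f y \<and> (f x \<in> P \<and> f y \<in> P \<or> f x \<in> Q \<and> f y \<in> Q)"
        by (simp add: two_cliques_def)
      with True inj show ?thesis by (auto simp: P'_def Q'_def dest: inj_onD)
    next
      case False
      then show ?thesis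
        using G.in_arcsD1 G.in_arcsD2 by (auto simp: P'_def Q'_def)
    qed
    have "P' \<subseteq> pverts G" "Q' \<subseteq> pverts G"
      by (auto simp: P'_def Q'_def)
    then have PQ': "two_cliques G P' Q'"
      by (simp add: two_cliques_def set_eq_iff split_paired_all adj)
    have card_pullback: "card {x \<in> pverts G. f x \<in> S} = card S" if "S \<subseteq> pverts H" for S
    proof -
      have "f ` {x \<in> pverts G. f x \<in> S} = f ` pverts G \<inter> S" by auto
      then have "f ` {x \<in> pverts G. f x \<in> S} = S" using that img by auto
      moreover have "inj_on f {x \<in> pverts G. f x \<in> S}"
        using inj by (rule inj_on_subset) auto
      ultimately show ?thesis by (metis card_image)
    qed
    have "P' - Q' = {x \<in> pverts G. f x \<in> P - Q}" "Q' - P' = {x \<in> pverts G. f x \<in> Q - P}"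
      "P' \<inter> Q' = {x \<in> pverts G. f x \<in> P \<inter> Q}"
      "pverts G - (P' \<union> Q') = {x \<in> pverts G. f x \<in> pverts H - (P \<union> Q)}"
      using img by (auto simp: P'_def Q'_def)
    moreover have "P - Q \<subseteq> pverts H" "Q - P \<subseteq> pverts H" "P \<inter> Q \<subseteq> pverts H"
      using sub by auto
    ultimately have "card (P' - Q') = m" "card (Q' - P') = n" "card (P' \<inter> Q') = q"
      "card (pverts G - (P' \<union> Q')) = r"
      by (simp_all only: card_pullback cards Diff_subset)
    with PQ' show "two_cliques_type G m n q r"
      unfolding two_cliques_type_def by blast
  next
    assume "two_cliques_type G m n q r"
    then obtain P' Q' where PQ': "two_cliques G P' Q'" and cards': "card (P' - Q') = m"
        "card (Q' - P') = n" "card (P' \<inter> Q') = q" "card (pverts G - (P' \<union> Q')) = r"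
      by (auto simp: two_cliques_type_def)
    have sub': "P' \<subseteq> pverts G" "Q' \<subseteq> pverts G"
      using PQ' by (auto simp: two_cliques_def)
    have fibres: "{x \<in> V. (x \<in> A, x \<in> B) = (True, False)} = A - B"
        "{x \<in> V. (x \<in> A, x \<in> B) = (False, True)} = B - A"
        "{x \<in> V. (x \<in> A, x \<in> B) = (True, True)} = A \<inter> B"
        "{x \<in> V. (x \<in> A, x \<in> B) = (False, False)} = V - (A \<union> B)"
      if "A \<subseteq> V" "B \<subseteq> V" for A B V :: "'c set"
      using that by auto
    have "card {x \<in> pverts G. (x \<in> P', x \<in> Q') = c} = card {y \<in> pverts H. (y \<in> P, y \<in> Q) = c}" for c
    proof (cases c)
      case (Pair a b)
      show ?thesis
        unfolding Pair using cards cards'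
        by (cases a; cases b) (simp_all only: fibres[OF sub] fibres[OF sub'])
    qed
    then obtain h where h: "bij_betw h (pverts G) (pverts H)"
      and lab: "\<And>x. x \<in> pverts G \<Longrightarrow> (h x \<in> P, h x \<in> Q) = (x \<in> P', x \<in> Q')"
      using bij_betw_matching_labels[OF G.pair_finite_verts fin,
          of "\<lambda>x. (x \<in> P', x \<in> Q')" "\<lambda>y. (y \<in> P, y \<in> Q)"] by blast
    have "h x = h y \<longleftrightarrow> x = y" if "x \<in> pverts G" "y \<in> pverts G" for x y
      using bij_betw_imp_inj_on[OF h] that by (auto dest: inj_onD)
    with lab have "\<forall>x\<in>pverts G. \<forall>y\<in>pverts G. (x, y) \<in> parcs G \<longleftrightarrow> (h x, h y) \<in> parcs H"
      using PQ PQ' by (auto simp: two_cliques_def)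
    with h show "graph_iso G H" unfolding iso by blast
  qed
qed

section \<open>The five families\<close>

lemma two_cliques_typeI:
  assumes "two_cliques G P Q" "P - Q = A" "Q - P = B" "P \<inter> Q = C" "pverts G - (P \<union> Q) = D"
  shows "two_cliques_type G (card A) (card B) (card C) (card D)"
  using assms unfolding two_cliques_type_def by blast

lemma type_edgeless_graph: "two_cliques_type (edgeless_graph r) 0 0 0 r"
  using two_cliques_typeI[of "edgeless_graph r" "{}" "{}" "{}" "{}" "{}" "{..<r}"]
  by (simp add: two_cliques_def edgeless_graph_def)

lemma type_two_complete_graphs:
  "two_cliques_type (disjoint_union (complete_graph m) (complete_graph n)) m n 0 0"
proof -
  let ?P = "Inl ` {..<m} :: (nat + nat) set" and ?Q = "Inr ` {..<n} :: (nat + nat) set"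
  have "two_cliques (disjoint_union (complete_graph m) (complete_graph n)) ?P ?Q"
    by (auto simp: two_cliques_def disjoint_union_def complete_graph_def)
  from two_cliques_typeI[OF this, of ?P ?Q "{}" "{}"] show ?thesis
    by (auto simp: disjoint_union_def complete_graph_def card_image)
qed

text \<open>Adding isolated vertices on either side only enlarges the fourth cell.\<close>

lemma type_disjoint_union_edgeless_graph:
  assumes "two_cliques_type G m n q 0" "finite (pverts G)"
  shows "two_cliques_type (disjoint_union G (edgeless_graph r)) m n q r"
    and "two_cliques_type (disjoint_union (edgeless_graph r) G) m n q r"
proof -
  obtain P Q where PQ: "two_cliques G P Q" and cards: "card (P - Q) = m" "card (Q - P) = n"
      "card (P \<inter> Q) = q" "card (pverts G - (P \<union> Q)) = 0"
    using assms(1) by (auto simp: two_cliques_type_def)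
  have cover: "pverts G = P \<union> Q"
    using cards(4) PQ assms(2) by (auto simp: two_cliques_def)
  let ?l = "\<lambda>S. Inl ` S :: ('a + nat) set" and ?r = "\<lambda>S. Inr ` S :: (nat + 'a) set"
  have "two_cliques (disjoint_union G (edgeless_graph r)) (?l P) (?l Q)"
    using PQ by (auto simp: two_cliques_def disjoint_union_def edgeless_graph_def image_iff)
  from two_cliques_typeI[OF this, of "?l (P - Q)" "?l (Q - P)" "?l (P \<inter> Q)" "Inr ` {..<r}"]
  show "two_cliques_type (disjoint_union G (edgeless_graph r)) m n q r"
    using cards by (auto simp: disjoint_union_def edgeless_graph_def cover card_image)
  have "two_cliques (disjoint_union (edgeless_graph r) G) (?r P) (?r Q)"
    using PQ by (auto simp: two_cliques_def disjoint_union_def edgeless_graph_def image_iff)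
  from two_cliques_typeI[OF this, of "?r (P - Q)" "?r (Q - P)" "?r (P \<inter> Q)" "Inl ` {..<r}"]
  show "two_cliques_type (disjoint_union (edgeless_graph r) G) m n q r"
    using cards by (auto simp: disjoint_union_def edgeless_graph_def cover card_image)
qed

text \<open>
  In the complement each side of the bipartition becomes a clique together with all \<open>q\<close> formerly
  isolated vertices, so these \<open>q\<close> vertices form the overlap.
\<close>

lemma type_complement_bipartite:
  "two_cliques_type (graph_complement
     (disjoint_union (complete_bipartite_graph m n) (edgeless_graph q))) m n q 0"
  (is "two_cliques_type ?G _ _ _ _")
proof -
  let ?A = "(\<lambda>i. Inl (Inl i)) ` {..<m} :: ((nat + nat) + nat) set"
  let ?B = "(\<lambda>i. Inl (Inr i)) ` {..<n} :: ((nat + nat) + nat) set"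
  let ?C = "Inr ` {..<q} :: ((nat + nat) + nat) set"
  have "two_cliques ?G (?A \<union> ?C) (?B \<union> ?C)"
    by (auto simp: two_cliques_def graph_complement_def disjoint_union_def
        complete_bipartite_graph_def edgeless_graph_def)
  from two_cliques_typeI[OF this, of ?A ?B ?C "{}"] show ?thesis
    by (auto simp: graph_complement_def disjoint_union_def complete_bipartite_graph_def
        edgeless_graph_def card_image inj_on_def)
qed

lemma finite_pverts_families:
  "finite (pverts (edgeless_graph q))"
  "finite (pverts (complete_graph q))"
  "finite (pverts (complete_bipartite_graph m n))"
  "finite (pverts G) \<Longrightarrow> finite (pverts (graph_complement G))"
  "finite (pverts G) \<Longrightarrow> finite (pverts H) \<Longrightarrow> finite (pverts (disjoint_union G H))"
  by (simp_all add: edgeless_graph_def complete_graph_def complete_bipartite_graph_def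
      graph_complement_def disjoint_union_def)

section \<open>Niche graphs of interval orders\<close>

lemma interval_order_iff_endpoints:
  fixes D :: "'a pair_pre_digraph"
  shows "interval_order D \<longleftrightarrow> pair_fin_digraph D \<and> pverts D \<noteq> {} \<and>
     (\<exists>l r :: 'a \<Rightarrow> real. (\<forall>x\<in>pverts D. l x \<le> r x) \<and>
        (\<forall>x\<in>pverts D. \<forall>y\<in>pverts D. (x, y) \<in> parcs D \<longleftrightarrow> r y < l x))"
proof -
  have "(\<exists>J :: 'a \<Rightarrow> real set. (\<forall>x\<in>pverts D. \<exists>a b. a \<le> b \<and> J x = {a..b}) \<and>
      (\<forall>x\<in>pverts D. \<forall>y\<in>pverts D. (x, y) \<in> parcs D \<longleftrightarrow> Inf (J x) > Sup (J y))) \<longleftrightarrow>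
    (\<exists>l r :: 'a \<Rightarrow> real. (\<forall>x\<in>pverts D. l x \<le> r x) \<and>
      (\<forall>x\<in>pverts D. \<forall>y\<in>pverts D. (x, y) \<in> parcs D \<longleftrightarrow> r y < l x))"
    (is "?intervals \<longleftrightarrow> ?endpoints")
  proof
    assume ?intervals
    then obtain J :: "'a \<Rightarrow> real set"
      where J: "\<forall>x\<in>pverts D. \<exists>a b. a \<le> b \<and> J x = {a..b}"
        and arcs: "\<forall>x\<in>pverts D. \<forall>y\<in>pverts D. (x, y) \<in> parcs D \<longleftrightarrow> Inf (J x) > Sup (J y)"
      by blast
    have "Inf (J x) \<le> Sup (J x)" if "x \<in> pverts D" for x
      using J that by fastforce
    with arcs show ?endpoints
      by (intro exI[of _ "\<lambda>x. Inf (J x)"] exI[of _ "\<lambda>x. Sup (J x)"]) simp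
  next
    assume ?endpoints
    then obtain l r :: "'a \<Rightarrow> real" where "\<forall>x\<in>pverts D. l x \<le> r x"
      "\<forall>x\<in>pverts D. \<forall>y\<in>pverts D. (x, y) \<in> parcs D \<longleftrightarrow> r y < l x" by blast
    then show ?intervals
      by (intro exI[of _ "\<lambda>x. {l x..r x}"]) auto
  qed
  then show ?thesis
    by (simp only: interval_order_def)
qed

text \<open>
  Neighbourhoods are nested along the endpoints, so the smaller of two nonempty ones is contained
  in their intersection.
\<close>

lemma two_cliques_niche_graph:
  assumes "interval_order D"
  shows "two_cliques (niche_graph D)
    {x \<in> pverts D. out_nbrs D x \<noteq> {}} {x \<in> pverts D. in_nbrs D x \<noteq> {}}"
proof -
  obtain l r :: "'a \<Rightarrow> real"
    where arcs: "\<And>x y. x \<in> pverts D \<Longrightarrow> y \<in> pverts D \<Longrightarrow> (x, y) \<in> parcs D \<longleftrightarrow> r y < l x"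
    using assms unfolding interval_order_iff_endpoints by blast
  have "out_nbrs D x \<subseteq> out_nbrs D y \<or> out_nbrs D y \<subseteq> out_nbrs D x"
    if "x \<in> pverts D" "y \<in> pverts D" for x y
    using that linear[of "l x" "l y"] by (auto simp: out_nbrs_def arcs)
  then have out: "out_nbrs D x \<inter> out_nbrs D y \<noteq> {} \<longleftrightarrow> out_nbrs D x \<noteq> {} \<and> out_nbrs D y \<noteq> {}"
    if "x \<in> pverts D" "y \<in> pverts D" for x y
    using that by blast
  have "in_nbrs D x \<subseteq> in_nbrs D y \<or> in_nbrs D y \<subseteq> in_nbrs D x"
    if "x \<in> pverts D" "y \<in> pverts D" for x y
    using that linear[of "r x" "r y"] by (auto simp: in_nbrs_def arcs)
  then have "in": "in_nbrs D x \<inter> in_nbrs D y \<noteq> {} \<longleftrightarrow> in_nbrs D x \<noteq> {} \<and> in_nbrs D y \<noteq> {}"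
    if "x \<in> pverts D" "y \<in> pverts D" for x y
    using that by blast
  define P Q where "P = {x \<in> pverts D. out_nbrs D x \<noteq> {}}"
    and "Q = {x \<in> pverts D. in_nbrs D x \<noteq> {}}"
  have "(x, y) \<in> parcs (niche_graph D) \<longleftrightarrow> x \<noteq> y \<and> (x \<in> P \<and> y \<in> P \<or> x \<in> Q \<and> y \<in> Q)"
    for x y
    using out[of x y] "in"[of x y] unfolding niche_graph_def P_def Q_def
    by (simp del: Int_iff) blast
  moreover have "P \<subseteq> pverts (niche_graph D)" "Q \<subseteq> pverts (niche_graph D)"
    by (auto simp: P_def Q_def niche_graph_def)
  ultimately show ?thesis
    unfolding P_def[symmetric] Q_def[symmetric]
    by (simp add: two_cliques_def set_eq_iff split_paired_all)
qed

text \<open>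
  The witnesses are an interval with the largest left endpoint and one with the smallest right
  endpoint: nothing lies to the right of the former or to the left of the latter.
\<close>

lemma interval_order_end_vertices:
  assumes "interval_order D" and uv: "u \<in> pverts D" "v \<in> pverts D" "(u, v) \<in> parcs D"
  shows "\<exists>x\<in>pverts D. out_nbrs D x \<noteq> {} \<and> in_nbrs D x = {}"
    and "\<exists>x\<in>pverts D. in_nbrs D x \<noteq> {} \<and> out_nbrs D x = {}"
proof -
  obtain l r :: "'a \<Rightarrow> real" where lr: "\<And>x. x \<in> pverts D \<Longrightarrow> l x \<le> r x"
    and arcs: "\<And>x y. x \<in> pverts D \<Longrightarrow> y \<in> pverts D \<Longrightarrow> (x, y) \<in> parcs D \<longleftrightarrow> r y < l x"
    using assms unfolding interval_order_iff_endpoints by blast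
  have fin: "finite (pverts D)"
    using assms(1) by (auto simp: interval_order_def intro: pair_fin_digraph.pair_finite_verts)
  have ruv: "r v < l u" using arcs uv by blast
  obtain x where x: "x \<in> pverts D" "\<And>y. y \<in> pverts D \<Longrightarrow> l y \<le> l x"
    using fin uv(1) Max_in[of "l ` pverts D"] Max_ge[of "l ` pverts D"]
    by (metis (no_types, lifting) empty_iff finite_imageI imageE image_eqI image_is_empty)
  have "v \<in> out_nbrs D x"
    using x(1) x(2)[OF uv(1)] ruv uv(2) by (simp add: out_nbrs_def arcs)
  moreover have "in_nbrs D x = {}"
    using x lr[OF x(1)] by (force simp: in_nbrs_def arcs)
  ultimately show "\<exists>x\<in>pverts D. out_nbrs D x \<noteq> {} \<and> in_nbrs D x = {}"
    using x(1) by blast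
  obtain y where y: "y \<in> pverts D" "\<And>x. x \<in> pverts D \<Longrightarrow> r y \<le> r x"
    using fin uv(1) Min_in[of "r ` pverts D"] Min_le[of "r ` pverts D"]
    by (metis (no_types, lifting) empty_iff finite_imageI imageE image_eqI image_is_empty)
  have "u \<in> in_nbrs D y"
    using y(1) y(2)[OF uv(2)] ruv uv(1) by (simp add: in_nbrs_def arcs)
  moreover have "out_nbrs D y = {}"
    using y lr[OF y(1)] by (force simp: out_nbrs_def arcs)
  ultimately show "\<exists>x\<in>pverts D. in_nbrs D x \<noteq> {} \<and> out_nbrs D x = {}"
    using y(1) by blast
qed

text \<open>
  The intervals are chosen so that \<open>P\<close> and \<open>Q\<close> become the vertices with an out-neighbour and with an
  in-neighbour. The point \<open>1\<close> for \<open>P \<inter> Q\<close> lies strictly between the two extreme points, whereas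
  \<open>[0, 2]\<close> meets all other intervals and so leaves its vertices isolated.
\<close>

lemma two_cliques_realizable:
  assumes G: "pair_graph G" "pverts G \<noteq> {}" and PQ: "two_cliques G P Q"
    and ends: "P = {} \<and> Q = {} \<or> P - Q \<noteq> {} \<and> Q - P \<noteq> {}"
  shows "\<exists>D. interval_order D \<and> niche_graph D = G"
proof -
  interpret G: pair_graph G by (rule G)
  define l :: "'a \<Rightarrow> real" where "l x = (if x \<in> P then if x \<in> Q then 1 else 2 else 0)" for x
  define r :: "'a \<Rightarrow> real" where "r x = (if x \<in> Q then if x \<in> P then 1 else 0 else 2)" for x
  define D where "D = \<lparr> pverts = pverts G,
    parcs = {(x, y). x \<in> pverts G \<and> y \<in> pverts G \<and> r y < l x} \<rparr>"
  have "parcs D \<subseteq> pverts G \<times> pverts G" by (auto simp: D_def)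
  then have "finite (parcs D)" by (rule finite_subset) simp
  then have "pair_fin_digraph D"
    by unfold_locales (auto simp: D_def)
  moreover have "\<forall>x\<in>pverts D. l x \<le> r x" by (simp add: l_def r_def)
  ultimately have D: "interval_order D"
    using G(2) unfolding interval_order_iff_endpoints
    by (intro conjI exI[of _ l] exI[of _ r]) (auto simp: D_def)
  have sub: "P \<subseteq> pverts G" "Q \<subseteq> pverts G" using PQ by (auto simp: two_cliques_def)
  have "out_nbrs D x \<noteq> {} \<longleftrightarrow> x \<in> P" if x: "x \<in> pverts D" for x
  proof
    assume "x \<in> P"
    with ends obtain z where "z \<in> Q" "z \<notin> P" by blast
    with \<open>x \<in> P\<close> sub have "z \<in> out_nbrs D x"
      by (auto simp: out_nbrs_def D_def l_def r_def)
    then show "out_nbrs D x \<noteq> {}" by blast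
  next
    have "0 \<le> r y" for y by (simp add: r_def)
    moreover assume "out_nbrs D x \<noteq> {}"
    ultimately have "0 < l x" by (force simp: out_nbrs_def D_def intro: le_less_trans)
    then show "x \<in> P" by (simp add: l_def split: if_splits)
  qed
  then have "{x \<in> pverts D. out_nbrs D x \<noteq> {}} = P"
    using sub by (auto simp: D_def)
  moreover have "in_nbrs D x \<noteq> {} \<longleftrightarrow> x \<in> Q" if x: "x \<in> pverts D" for x
  proof
    assume "x \<in> Q"
    with ends obtain z where "z \<in> P" "z \<notin> Q" by blast
    with \<open>x \<in> Q\<close> sub have "z \<in> in_nbrs D x"
      by (auto simp: in_nbrs_def D_def l_def r_def)
    then show "in_nbrs D x \<noteq> {}" by blast
  next
    have "l y \<le> 2" for y by (simp add: l_def)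
    moreover assume "in_nbrs D x \<noteq> {}"
    ultimately have "r x < 2" by (force simp: in_nbrs_def D_def intro: less_le_trans)
    then show "x \<in> Q" by (simp add: r_def split: if_splits)
  qed
  then have "{x \<in> pverts D. in_nbrs D x \<noteq> {}} = Q"
    using sub by (auto simp: D_def)
  ultimately have "two_cliques (niche_graph D) P Q"
    using two_cliques_niche_graph[OF D] by simp
  then have "niche_graph D = G"
    using PQ by (rule two_cliques_unique) (simp add: niche_graph_def D_def)
  with D show ?thesis by blast
qed

lemma niche_graph_interval_order_iff_type:
  assumes G: "pair_graph G" "pverts G \<noteq> {}"
  shows "(\<exists>D. interval_order D \<and> niche_graph D = G) \<longleftrightarrow>
    (\<exists>m n q r. two_cliques_type G m n q r \<and> (m = 0 \<and> n = 0 \<and> q = 0 \<or> 0 < m \<and> 0 < n))"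
proof -
  interpret G: pair_graph G by (rule G)
  have fin: "finite P" "finite Q" if "two_cliques G P Q" for P Q
    using that by (auto simp: two_cliques_def intro: finite_subset[OF _ G.pair_finite_verts])
  show ?thesis
  proof
    assume "\<exists>D. interval_order D \<and> niche_graph D = G"
    then obtain D where D: "interval_order D" and GD: "niche_graph D = G" by blast
    define P Q where "P = {x \<in> pverts D. out_nbrs D x \<noteq> {}}"
      and "Q = {x \<in> pverts D. in_nbrs D x \<noteq> {}}"
    have PQ: "two_cliques G P Q"
      using two_cliques_niche_graph[OF D] by (simp add: GD P_def Q_def)
    have "P = {} \<and> Q = {} \<or> P - Q \<noteq> {} \<and> Q - P \<noteq> {}"
    proof (cases "\<exists>u\<in>pverts D. \<exists>v\<in>pverts D. (u, v) \<in> parcs D")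
      case True
      then obtain u v where "u \<in> pverts D" "v \<in> pverts D" "(u, v) \<in> parcs D" by blast
      from interval_order_end_vertices[OF D this] have "P - Q \<noteq> {}" "Q - P \<noteq> {}"
        unfolding P_def Q_def by blast+
      then show ?thesis by blast
    next
      case False
      then show ?thesis by (auto simp: P_def Q_def out_nbrs_def in_nbrs_def)
    qed
    then have "card (P - Q) = 0 \<and> card (Q - P) = 0 \<and> card (P \<inter> Q) = 0 \<or>
        0 < card (P - Q) \<and> 0 < card (Q - P)"
      using fin[OF PQ] by (auto simp: card_gt_0_iff)
    moreover have "two_cliques_type G (card (P - Q)) (card (Q - P)) (card (P \<inter> Q))
        (card (pverts G - (P \<union> Q)))"
      using PQ by (intro two_cliques_typeI) auto
    ultimately show "\<exists>m n q r. two_cliques_type G m n q r \<and>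
        (m = 0 \<and> n = 0 \<and> q = 0 \<or> 0 < m \<and> 0 < n)" by blast
  next
    assume "\<exists>m n q r. two_cliques_type G m n q r \<and> (m = 0 \<and> n = 0 \<and> q = 0 \<or> 0 < m \<and> 0 < n)"
    then obtain P Q where PQ: "two_cliques G P Q"
      and cards: "card (P - Q) = 0 \<and> card (Q - P) = 0 \<and> card (P \<inter> Q) = 0 \<or>
        0 < card (P - Q) \<and> 0 < card (Q - P)"
      unfolding two_cliques_type_def by auto
    have "P = {} \<and> Q = {} \<or> P - Q \<noteq> {} \<and> Q - P \<noteq> {}"
      using cards fin[OF PQ] by (auto simp: card_gt_0_iff)
    with G PQ show "\<exists>D. interval_order D \<and> niche_graph D = G"
      by (rule two_cliques_realizable)
  qed
qed

section \<open>The characterization\<close>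

theorem theorem4:
  fixes G :: "'a pair_pre_digraph"
  assumes "pair_graph G" and "pverts G \<noteq> {}"
  shows "(\<exists>D :: 'a pair_pre_digraph. interval_order D \<and> niche_graph D = G) \<longleftrightarrow>
    (\<exists>m n q r :: nat. 0 < m \<and> 0 < n \<and> 0 < q \<and> 0 < r \<and>
      (graph_iso G (edgeless_graph q)
     \<or> graph_iso G (disjoint_union (complete_graph m) (complete_graph n))
     \<or> graph_iso G (disjoint_union (disjoint_union (complete_graph m) (complete_graph n))
                      (edgeless_graph r))
     \<or> graph_iso G (graph_complement
                      (disjoint_union (complete_bipartite_graph m n) (edgeless_graph q)))
     \<or> graph_iso G (disjoint_union (edgeless_graph r)
                      (graph_complement
                        (disjoint_union (complete_bipartite_graph m n) (edgeless_graph q))))))"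
proof -
  interpret G: pair_graph G by (rule assms(1))
  let ?T = "two_cliques_type G"
  have edgeless_nonempty: "0 < r" if T: "?T 0 0 0 r" for r
  proof -
    obtain P Q where "two_cliques G P Q"
      and cards: "card (P - Q) = 0" "card (Q - P) = 0" "card (P \<inter> Q) = 0"
        "card (pverts G - (P \<union> Q)) = r"
      using T unfolding two_cliques_type_def by blast
    then have PQ: "P \<subseteq> pverts G" "Q \<subseteq> pverts G" by (simp_all add: two_cliques_def)
    note fin = G.pair_finite_verts
    with PQ have "finite P" "finite Q" by (simp_all add: finite_subset)
    with cards have "P = {}" "Q = {}" by auto
    with cards(4) fin assms(2) show "0 < r" by (auto simp: card_gt_0_iff)
  qed
  note iso = graph_iso_iff_two_cliques_type[OF assms(1)]
  note families =
    iso[OF _ type_edgeless_graph] iso[OF _ type_two_complete_graphs]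
    iso[OF _ type_disjoint_union_edgeless_graph(1)[OF type_two_complete_graphs]]
    iso[OF _ type_complement_bipartite]
    iso[OF _ type_disjoint_union_edgeless_graph(2)[OF type_complement_bipartite]]
  have "(\<exists>m n q r. ?T m n q r \<and> (m = 0 \<and> n = 0 \<and> q = 0 \<or> 0 < m \<and> 0 < n)) \<longleftrightarrow>
    (\<exists>m n q r. 0 < m \<and> 0 < n \<and> 0 < q \<and> 0 < r \<and>
      (?T 0 0 0 q \<or> ?T m n 0 0 \<or> ?T m n 0 r \<or> ?T m n q 0 \<or> ?T m n q r))"
    (is "?L \<longleftrightarrow> ?R")
  proof
    assume ?L
    then obtain m n q r where T: "?T m n q r" and c: "m = 0 \<and> n = 0 \<and> q = 0 \<or> 0 < m \<and> 0 < n"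
      by blast
    show ?R
    proof (cases "m = 0")
      case True
      with T c edgeless_nonempty have "?T 0 0 0 r" "0 < r" by auto
      then show ?thesis by (intro exI[of _ 1] exI[of _ r]) simp
    next
      case False
      \<comment> \<open>A size that is \<open>0\<close> does not occur in the family chosen; \<open>1\<close> is a placeholder.\<close>
      define q' r' where "q' = max 1 q" and "r' = max 1 r"
      have "0 < q'" "0 < r'" "q = 0 \<or> q = q'" "r = 0 \<or> r = r'"
        by (auto simp: q'_def r'_def)
      with T have "?T m n 0 0 \<or> ?T m n 0 r' \<or> ?T m n q' 0 \<or> ?T m n q' r'" by metis
      moreover have "0 < m" "0 < n" using c False by auto
      ultimately show ?thesis using \<open>0 < q'\<close> \<open>0 < r'\<close> by blast
    qed
  next
    assume ?R
    then show ?L by blast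
  qed
  then show ?thesis
    unfolding niche_graph_interval_order_iff_type[OF assms]
    by (simp add: families finite_pverts_families)
qed

end
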